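(* Let $d$ be an integer with $2\le d\le 20$, let $p>d$ be a prime, let $q=p^n$ with $n\ge 1$ an integer, and let $\Gamma=\{(\xi,\xi^2,\ldots,\xi^d):\xi\in\mathbb{F}_q\}\subset\mathbb{F}_q^{d}$ be the moment curve. Then for every function $f:\Gamma\to\mathbb{C}$, $$\|(f\sigma)^{\vee}\|_{L^{2d}(\mathbb{F}_q^d,\mathrm{d}\mathbf{x})}\le\left(\frac{1}{q^d}\sum_{\ell\in\mathcal{P}_d}\binom{d}{\ell}^2\binom{q}{b(\ell)}\right)^{\frac{1}{2d}}\|f\|_{L^2(\Gamma,\mathrm{d}\sigma)},$$ and this inequality is sharp, i.e. the constant on the right-hand side cannot be replaced by any smaller one. Moreover, a non-zero function $f:\Gamma\to\mathbb{C}$ is a maximizer of this inequality (i.e. attains equality) if and only if $|f|$ is constant on $\Gamma$.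
   Context: $\mathbb{F}_q$ is the finite field with $q=p^n$ elements. Let $\mathrm{Tr}:\mathbb{F}_q\to\mathbb{F}_p$, $\mathrm{Tr}(y)=y+y^p+\cdots+y^{p^{n-1}}$, and $e(y)=\exp(2\pi i\,\mathrm{Tr}(y)/p)$ for $y\in\mathbb{F}_q$. For $\mathbf{x},\boldsymbol{\xi}\in\mathbb{F}_q^d$ put $\mathbf{x}\cdot\boldsymbol{\xi}=\sum_{i=1}^d x_i\xi_i$. The measure $\mathrm{d}\mathbf{x}$ is counting measure on $\mathbb{F}_q^d$, and $\sigma$ is the normalized counting measure on $\Gamma$ (note $|\Gamma|=q$). For $f:\Gamma\to\mathbb{C}$ the extension operator is $$(f\sigma)^{\vee}(\mathbf{x})=\frac1q\sum_{\boldsymbol{\xi}\in\Gamma}f(\boldsymbol{\xi})\,e(\mathbf{x}\cdot\boldsymbol{\xi}),\qquad \mathbf{x}\in\mathbb{F}_q^d.$$ Thus $\|(f\sigma)^\vee\|_{L^{2d}(\mathbb{F}_q^d,\mathrm{d}\mathbf{x})}=\left(\sum_{\mathbf{x}\in\mathbb{F}_q^d}|(f\sigma)^\vee(\mathbf{x})|^{2d}\right)^{1/(2d)}$ and $\|f\|_{L^2(\Gamma,\mathrm{d}\sigma)}=\left(\frac1q\sum_{\boldsymbol{\xi}\in\Gamma}|f(\boldsymbol{\xi})|^2\right)^{1/2}$. $\mathcal{P}_d=\{\ell=(\ell_1,\ldots,\ell_d)\in\mathbb{Z}^d:\ \ell_1\ge\ell_2\ge\cdots\ge\ell_d\ge 0,\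 \ell_1+\cdots+\ell_d=d\}$ is the set of partitions of $d$. For $\ell\in\mathcal{P}_d$ let $b(\ell)=(b_0(\ell),b_1(\ell),\ldots,b_d(\ell))$, where $b_j(\ell)=|\{1\le i\le d:\ell_i=j\}|$ for $1\le j\le d$ and $b_0(\ell)=|\{1\le i\le d:\ell_i=0\}|+(q-d)$. The multinomial coefficients are $$\binom{d}{\ell}=\frac{d!}{\ell_1!\,\ell_2!\cdots\ell_d!},\qquad \binom{q}{b(\ell)}=\frac{q!}{b_0(\ell)!\,b_1(\ell)!\cdots b_d(\ell)!}.$$ A maximizer is a non-zero function for which equality holds in the inequality. *)

theory Defs
  imports "HOL-Analysis.Analysis" "HOL-Number_Theory.Number_Theory"
begin

definition field_trace :: "nat \<Rightarrow> nat \<Rightarrow> 'a :: finite_field \<Rightarrow> 'a" where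
  "field_trace p n y = (\<Sum>i<n. y ^ (p ^ i))"

text \<open>
  The trace lies in the prime subfield; to form \<open>exp (2\<pi>i Tr(y) / p)\<close> it is identified with its
  representative in \<open>{0..<p}\<close>. See \<open>ex1_trace_residue\<close> below for existence and uniqueness.
\<close>
definition prime_residue :: "nat \<Rightarrow> 'a :: finite_field \<Rightarrow> nat" where
  "prime_residue p y = (THE k. k < p \<and> of_nat k = y)"

definition add_char :: "nat \<Rightarrow> nat \<Rightarrow> 'a :: finite_field \<Rightarrow> complex" where
  "add_char p n y =
     exp (2 * of_real pi * \<i> * of_nat (prime_residue p (field_trace p n y)) / of_nat p)"

text \<open>Vectors over a field, of dimension \<open>d\<close>, are extensional functions on \<open>{1..d}\<close>.\<close>
definition vec_space :: "nat \<Rightarrow> (nat \<Rightarrow> 'a :: finite_field) set" where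
  "vec_space d = {1..d} \<rightarrow>\<^sub>E UNIV"

definition dot :: "nat \<Rightarrow> (nat \<Rightarrow> 'a :: finite_field) \<Rightarrow> (nat \<Rightarrow> 'a) \<Rightarrow> 'a" where
  "dot d x \<xi> = (\<Sum>i=1..d. x i * \<xi> i)"

definition moment_curve :: "nat \<Rightarrow> (nat \<Rightarrow> 'a :: finite_field) set" where
  "moment_curve d = range (\<lambda>t. \<lambda>i\<in>{1..d}. t ^ i)"

text \<open>
  A function on the moment curve is represented by a function on all of \<open>nat \<Rightarrow> 'a\<close>;
  only its values on \<open>moment_curve d\<close> are ever used.
\<close>
definition extension_op ::
  "nat \<Rightarrow> nat \<Rightarrow> nat \<Rightarrow> ((nat \<Rightarrow> 'a :: finite_field) \<Rightarrow> complex) \<Rightarrow> (nat \<Rightarrow> 'a) \<Rightarrow> complex" where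
  "extension_op p n d f x =
     1 / of_nat CARD('a) * (\<Sum>\<xi>\<in>moment_curve d. f \<xi> * add_char p n (dot d x \<xi>))"

definition norm_L :: "nat \<Rightarrow> nat \<Rightarrow> ((nat \<Rightarrow> 'a :: finite_field) \<Rightarrow> complex) \<Rightarrow> real" where
  "norm_L r d g = (\<Sum>x\<in>vec_space d. cmod (g x) ^ r) powr (1 / real r)"

definition norm_L2_curve :: "nat \<Rightarrow> ((nat \<Rightarrow> 'a :: finite_field) \<Rightarrow> complex) \<Rightarrow> real" where
  "norm_L2_curve d f =
     (1 / real CARD('a) * (\<Sum>\<xi>\<in>moment_curve d. (cmod (f \<xi>))\<^sup>2)) powr (1 / 2)"

definition partitions :: "nat \<Rightarrow> (nat \<Rightarrow> nat) set" where
  "partitions d = {l \<in> {1..d} \<rightarrow>\<^sub>E UNIV. antimono_on {1..d} l \<and> (\<Sum>i=1..d. l i) = d}"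

text \<open>
  Multiplicities \<open>b\<^sub>j\<close> of the parts of \<open>l\<close>, padded with zeros to \<open>q\<close> parts; only meaningful
  for \<open>d \<le> q\<close>, since the subtraction is truncated.
\<close>
definition part_mult :: "nat \<Rightarrow> nat \<Rightarrow> (nat \<Rightarrow> nat) \<Rightarrow> nat \<Rightarrow> nat" where
  "part_mult q d l j = card {i \<in> {1..d}. l i = j} + (if j = 0 then q - d else 0)"

definition multinomial :: "nat \<Rightarrow> 'i set \<Rightarrow> ('i \<Rightarrow> nat) \<Rightarrow> real" where
  "multinomial m I k = fact m / (\<Prod>i\<in>I. fact (k i))"

definition sharp_const :: "nat \<Rightarrow> nat \<Rightarrow> real" where
  "sharp_const q d =
     (1 / real q ^ d *
       (\<Sum>l\<in>partitions d. (multinomial d {1..d} l)\<^sup>2 * multinomial q {0..d} (part_mult q d l)))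
     powr (1 / real (2 * d))"

definition is_maximizer ::
  "nat \<Rightarrow> nat \<Rightarrow> nat \<Rightarrow> ((nat \<Rightarrow> 'a :: finite_field) \<Rightarrow> complex) \<Rightarrow> bool" where
  "is_maximizer p n d f \<longleftrightarrow>
     (\<exists>\<xi>\<in>moment_curve d. f \<xi> \<noteq> 0) \<and>
     norm_L (2 * d) d (extension_op p n d f) = sharp_const (p ^ n) d * norm_L2_curve d f"

lemma finite_partitions: "finite (partitions d)"
proof (rule finite_subset)
  show "partitions d \<subseteq> {1..d} \<rightarrow>\<^sub>E {..d}"
  proof
    fix l assume l: "l \<in> partitions d"
    have "l i \<le> d" if "i \<in> {1..d}" for i
      using member_le_sum[of i "{1..d}" l] that l by (auto simp: partitions_def)
    then show "l \<in> {1..d} \<rightarrow>\<^sub>E {..d}"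
      using l by (auto simp: partitions_def PiE_iff)
  qed
qed (auto intro: finite_PiE)

lemma char_eq_of_card:
  assumes "prime p" "CARD('a :: finite_field) = p ^ n"
  shows "CHAR('a) = p"
proof -
  have "CHAR('a) dvd CARD('a)" by (rule CHAR_dvd_CARD)
  moreover have "prime CHAR('a)" by (rule CHAR_prime)
  ultimately show ?thesis using assms
    using prime_dvd_power[of "CHAR('a)" p n] primes_dvd_imp_eq[of "CHAR('a)" p] by simp
qed

lemma ex1_trace_residue:
  fixes y :: "'a :: finite_field"
  assumes p: "prime p" and card: "CARD('a) = p ^ n"
  shows "\<exists>!k. k < p \<and> of_nat k = field_trace p n y"
proof -
  note char = char_eq_of_card[OF p card]
  have inj: "inj_on (of_nat :: nat \<Rightarrow> 'a) {..<p}"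
    by (auto simp: inj_on_def of_nat_eq_iff_cong_CHAR char cong_def)
  define R where "R = {x :: 'a. x ^ p = x}"
  have frob: "(a + b) ^ p = a ^ p + b ^ p" for a b :: 'a
    by (rule freshmans_dream) (simp_all add: char p)
  have "of_nat k \<in> R" for k
  proof (induction k)
    case 0
    show ?case using prime_gt_0_nat[OF p] by (simp add: R_def)
  next
    case (Suc k)
    then show ?case unfolding R_def of_nat_Suc mem_Collect_eq by (simp only: frob power_one)
  qed
  then have sub: "of_nat ` {..<p} \<subseteq> R" by auto
  define P :: "'a poly" where "P = Polynomial.monom 1 p - Polynomial.monom 1 1"
  have R: "R = {x. poly P x = 0}"
    by (auto simp: R_def P_def poly_monom)
  have deg: "degree P \<le> p"
    unfolding P_def
    by (intro degree_diff_le order.trans[OF degree_monom_le]) (use prime_ge_1_nat[OF p] in auto)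
  have "poly.coeff P p = 1"
    unfolding P_def using p by (auto dest: prime_gt_1_nat)
  then have "P \<noteq> 0" by auto
  then have "card R \<le> p"
    using card_poly_roots_bound[of P] deg unfolding R by simp
  then have eq: "of_nat ` {..<p} = R"
    using sub by (intro card_seteq) (auto simp: card_image inj)
  have yn: "y ^ (p ^ n) = y"
    using finite_field_power_card_eq_same[of y] card by simp
  have "field_trace p n y ^ p = (\<Sum>i<n. y ^ (p ^ Suc i))"
    unfolding field_trace_def
    by (subst freshmans_dream_sum) (simp_all add: char p mult.commute flip: power_mult)
  also have "y + \<dots> = field_trace p n y + y ^ (p ^ n)"
    unfolding field_trace_def using sum.lessThan_Suc_shift[of "\<lambda>i. y ^ (p ^ i)" n] by simp
  finally have "field_trace p n y \<in> R"
    using yn by (auto simp: R_def)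
  then obtain k where k: "k < p" "of_nat k = field_trace p n y"
    using eq by force
  show ?thesis
  proof (rule ex1I[of _ k])
    fix m assume "m < p \<and> of_nat m = field_trace p n y"
    with k show "m = k"
      using inj_onD[OF inj, of m k] by simp
  qed (use k in simp)
qed

end

theory Submission
  imports Defs "HOL-Combinatorics.Multiset_Permutations"
begin

text \<open>
  The \<open>d\<close>-th power of the extension of \<open>f\<close> is the Fourier transform of a \<open>d\<close>-fold convolution, so by
  orthogonality of characters the \<open>2d\<close>-th power of the norm of the extension counts, with weights, the pairs of
  \<open>d\<close>-tuples of parameters with the same power sums of orders \<open>1, \<dots>, d\<close>. As \<open>p > d\<close>, Newton's
  identities show that two such tuples are rearrangements of each other
  (\<open>multiset_eq_if_power_sums_eq\<close>). With \<open>a\<^sub>t\<close> the squared modulus of \<open>f\<close> at the parameter \<open>t\<close>, the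
  result (\<open>sum_norm_extension_op\<close>) is \<open>(d!)\<^sup>2 / q\<^sup>d\<close> times the coefficient of \<open>X\<^sup>d\<close> in
  \<open>\<Prod>t. I(a\<^sub>t X)\<close>, where \<open>I(X) = \<Sum>m. X\<^sup>m / (m!)\<^sup>2\<close>.

  It remains to maximise this coefficient over \<open>a \<ge> 0\<close> with given mean. For two variables,
  \<open>I(aX) I(bX)\<close> has coefficients that are polynomials in \<open>ab\<close> and \<open>a + b\<close> with nonnegative
  coefficients (\<open>bessel_fps_mult_nth\<close>); hence none of them decreases when \<open>a\<close> and \<open>b\<close> are moved towards
  each other with fixed sum, and those of order at least \<open>2\<close> increase strictly. Replacing values of \<open>a\<close> by the
  mean one after the other shows that the constant function is the only maximiser
  (\<open>bessel_coeff_less_mean\<close>).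

  For \<open>a = 1\<close> the coefficient is a sum over all multisets of size \<open>d\<close>, and grouping these by their
  multiplicities gives the sum over partitions in the sharp constant
  (\<open>fact_sq_bessel_coeff_one\<close>).
\<close>

section \<open>Coefficients of products of Bessel series\<close>

text \<open>
  The generating series \<open>I(aX)\<close>, where \<open>I(X) = \<Sum>m. X\<^sup>m / (m!)\<^sup>2\<close> is the modified Bessel function
  \<open>I\<^sub>0\<close> at \<open>2 \<surd>X\<close>.
\<close>
definition bessel_fps :: "real \<Rightarrow> real fps" where
  "bessel_fps a = Abs_fps (\<lambda>m. a ^ m / (fact m)\<^sup>2)"

lemma bessel_fps_nth [simp]: "fps_nth (bessel_fps a) m = a ^ m / (fact m)\<^sup>2"
  by (simp add: bessel_fps_def)

text \<open>
  The coefficient of \<open>X\<^sup>d\<close> in \<open>\<Prod>t. I(a\<^sub>t X)\<close>. With \<open>a\<^sub>t\<close> the squared modulus of \<open>f\<close> at the point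
  with parameter \<open>t\<close>, it is for \<open>d < p\<close> the \<open>2d\<close>-th power of the norm of the extension, up to a factor
  that does not depend on \<open>f\<close>.
\<close>
definition bessel_coeff :: "nat \<Rightarrow> ('a :: finite \<Rightarrow> real) \<Rightarrow> real" where
  "bessel_coeff d a = fps_nth (\<Prod>t\<in>UNIV. bessel_fps (a t)) d"

lemma bessel_coeff_eq_sum:
  "bessel_coeff d a =
     (\<Sum>M\<in>multisets_of_size UNIV d. \<Prod>t\<in>UNIV. a t ^ count M t / (fact (count M t))\<^sup>2)"
  by (simp add: bessel_coeff_def fps_prod_nth')

lemma size_eq_sum_count: "size (M :: 'a :: finite multiset) = (\<Sum>t\<in>UNIV. count M t)"
  unfolding size_multiset_overloaded_eq
  by (intro sum.mono_neutral_left) (auto simp: not_in_iff)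

lemma bessel_coeff_nonneg:
  assumes "\<And>t. 0 \<le> a t" shows "0 \<le> bessel_coeff d a"
  unfolding bessel_coeff_eq_sum using assms
  by (intro sum_nonneg prod_nonneg ballI divide_nonneg_nonneg zero_le_power) auto

lemma bessel_coeff_scale: "bessel_coeff d (\<lambda>t. c * a t) = c ^ d * bessel_coeff d a"
proof -
  have "(\<Prod>t\<in>UNIV. (c * a t) ^ count M t / (fact (count M t))\<^sup>2) =
        c ^ d * (\<Prod>t\<in>UNIV. a t ^ count M t / (fact (count M t))\<^sup>2)"
    if "M \<in> multisets_of_size UNIV d" for M
  proof -
    have "(\<Sum>t\<in>UNIV. count M t) = d"
      using that by (simp add: multisets_of_size_def size_eq_sum_count)
    then show ?thesis
      by (simp add: power_mult_distrib prod.distrib prod_dividef flip: power_sum)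
  qed
  then show ?thesis
    by (simp add: bessel_coeff_eq_sum sum_distrib_left)
qed

lemma coeff_linear_power_any:
  "poly.coeff ([:s, 1:] ^ n) k = of_nat (n choose k) * (s :: 'a :: comm_ring_1) ^ (n - k)"
proof (cases "k \<le> n")
  case False
  have "degree ([:s, 1:] ^ n) \<le> n"
    using degree_power_le[of "[:s, 1:]" n] by simp
  with False show ?thesis by (simp add: coeff_eq_0 binomial_eq_0)
qed (simp add: coeff_linear_poly_power)

text \<open>
  The left-hand side is \<open>(\<Sum>i. C(m, i)\<^sup>2 a\<^sup>i b\<^bsup>m - i\<^esup>) / (m!)\<^sup>2\<close>. Rewriting it in terms of \<open>ab\<close> and
  \<open>a + b\<close>, with nonnegative coefficients, makes the monotonicity in \<open>ab\<close> for fixed \<open>a + b\<close>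
  visible. Both numerators are the coefficient of \<open>X\<^sup>m\<close> in
  \<open>((a + X)(b + X))\<^sup>m = (ab + X(a + b + X))\<^sup>m\<close>.
\<close>
lemma bessel_fps_mult_nth:
  "fps_nth (bessel_fps a * bessel_fps b) m =
     (\<Sum>j\<le>m. real (m choose j) * real (m - j choose j) * (a * b) ^ j * (a + b) ^ (m - 2 * j)) / (fact m)\<^sup>2"
proof -
  have "(fact m)\<^sup>2 * fps_nth (bessel_fps a * bessel_fps b) m =
        (\<Sum>i\<le>m. (fact m)\<^sup>2 * (b ^ i / (fact i)\<^sup>2 * (a ^ (m - i) / (fact (m - i))\<^sup>2)))"
    by (subst mult.commute[of "bessel_fps a"]) (simp add: fps_mult_nth sum_distrib_left atLeast0AtMost)
  also have "\<dots> = (\<Sum>i\<le>m. poly.coeff ([:a, 1:] ^ m) i * poly.coeff ([:b, 1:] ^ m) (m - i))"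
  proof (intro sum.cong refl)
    fix i assume "i \<in> {..m}"
    then show "(fact m)\<^sup>2 * (b ^ i / (fact i)\<^sup>2 * (a ^ (m - i) / (fact (m - i))\<^sup>2)) =
      poly.coeff ([:a, 1:] ^ m) i * poly.coeff ([:b, 1:] ^ m) (m - i)"
      by (simp add: coeff_linear_power_any binomial_fact power2_eq_square field_simps)
  qed
  also have "\<dots> = poly.coeff (([:a, 1:] * [:b, 1:]) ^ m) m"
    by (simp only: power_mult_distrib coeff_mult)
  also have "[:a, 1:] * [:b, 1:] = [:a * b:] + Polynomial.monom 1 1 * [:a + b, 1:]"
    by (simp add: monom_altdef)
  also have "poly.coeff (\<dots> ^ m) m = (\<Sum>j\<le>m. poly.coeff (of_nat (m choose j) * [:a * b:] ^ j *
      (Polynomial.monom 1 1 * [:a + b, 1:]) ^ (m - j)) m)"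
    by (simp only: binomial_ring coeff_sum)
  also have "\<dots> = (\<Sum>j\<le>m. real (m choose j) * real (m - j choose j) * (a * b) ^ j * (a + b) ^ (m - 2 * j))"
  proof (intro sum.cong refl)
    fix j assume j: "j \<in> {..m}"
    have eq: "of_nat (m choose j) * [:a * b:] ^ j * (Polynomial.monom 1 1 * [:a + b, 1:]) ^ (m - j) =
        Polynomial.smult (real (m choose j) * (a * b) ^ j) (Polynomial.monom 1 (m - j) * [:a + b, 1:] ^ (m - j))"
      unfolding power_mult_distrib by (simp add: of_nat_poly monom_power poly_const_pow power_mult_distrib mult_ac)
    show "poly.coeff (of_nat (m choose j) * [:a * b:] ^ j * (Polynomial.monom 1 1 * [:a + b, 1:]) ^ (m - j)) m =
      real (m choose j) * real (m - j choose j) * (a * b) ^ j * (a + b) ^ (m - 2 * j)"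
      unfolding eq using j
      by (auto simp: coeff_monom_mult coeff_linear_power_any mult_2 simp del: mult_pCons_left mult_pCons_right)
  qed
  finally show ?thesis by (simp add: field_simps)
qed

lemma bessel_fps_mult_nth_mono:
  assumes "0 \<le> a + b" "a + b = a' + b'" "0 \<le> a * b" "a * b \<le> a' * b'"
  shows "fps_nth (bessel_fps a * bessel_fps b) m \<le> fps_nth (bessel_fps a' * bessel_fps b') m"
  unfolding bessel_fps_mult_nth assms(2)[symmetric]
  using assms(1,3) power_mono[OF assms(4,3)]
  by (intro divide_right_mono sum_mono mult_right_mono mult_left_mono) (simp_all del: zero_le_mult_iff)

lemma bessel_fps_mult_nth_strict_mono:
  assumes "0 < a + b" "a + b = a' + b'" "0 \<le> a * b" "a * b < a' * b'" "2 \<le> m"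
  shows "fps_nth (bessel_fps a * bessel_fps b) m < fps_nth (bessel_fps a' * bessel_fps b') m"
  unfolding bessel_fps_mult_nth assms(2)[symmetric]
  \<comment> \<open>The summand with \<open>j = 1\<close> increases strictly, as its coefficient is \<open>m (m - 1)\<close>.\<close>
proof (intro divide_strict_right_mono sum_strict_mono_ex1 bexI[of _ 1] ballI)
  fix j show "real (m choose j) * real (m - j choose j) * (a * b) ^ j * (a + b) ^ (m - 2 * j) \<le>
    real (m choose j) * real (m - j choose j) * (a' * b') ^ j * (a + b) ^ (m - 2 * j)"
    using assms(1) power_mono[OF less_imp_le[OF assms(4)] assms(3)]
    by (intro mult_right_mono mult_left_mono) simp_all
qed (use assms in simp_all)

text \<open>
  Smoothing: moving one of two values that lie on both sides of \<open>\<mu>\<close> to \<open>\<mu>\<close>, while their sum is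
  kept, increases their product and so increases the coefficient.
\<close>
lemma bessel_coeff_smoothing:
  fixes a :: "'a :: finite \<Rightarrow> real"
  assumes nonneg: "\<And>t. 0 \<le> a t" and "2 \<le> d" "a s < \<mu>" "\<mu> < a t"
  defines "a' \<equiv> a(s := \<mu>, t := a s + a t - \<mu>)"
  shows "bessel_coeff d a < bessel_coeff d a'"
proof -
  have "s \<noteq> t" using assms by auto
  define P where "P = (\<Prod>u\<in>UNIV - {s, t}. bessel_fps (a u))"
  have split: "(\<Prod>u\<in>UNIV. h u) = h s * h t * (\<Prod>u\<in>UNIV - {s, t}. h u)" for h :: "'a \<Rightarrow> real fps"
    using \<open>s \<noteq> t\<close> by (subst prod.subset_diff[of "{s, t}"]) (auto simp: mult_ac)
  have "P = (\<Prod>u\<in>UNIV - {s, t}. bessel_fps (a' u))"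
    unfolding P_def by (intro prod.cong) (auto simp: a'_def)
  then have eqs: "bessel_coeff d a = fps_nth (bessel_fps (a s) * bessel_fps (a t) * P) d"
    "bessel_coeff d a' = fps_nth (bessel_fps \<mu> * bessel_fps (a s + a t - \<mu>) * P) d"
    using \<open>s \<noteq> t\<close> by (simp_all add: bessel_coeff_def split a'_def P_def)
  have P_nonneg: "0 \<le> fps_nth P k" for k
    unfolding P_def by (subst fps_prod_nth')
      (auto intro!: sum_nonneg prod_nonneg divide_nonneg_nonneg zero_le_power nonneg)
  have P_0: "fps_nth P 0 = 1"
    unfolding P_def by (subst fps_prod_nth') auto
  have "(\<mu> - a s) * (a t - \<mu>) > 0" using assms by simp
  then have prod_less: "a s * a t < \<mu> * (a s + a t - \<mu>)"
    by (simp add: algebra_simps)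
  have sum_pos: "0 < a s + a t" using nonneg[of s] assms by linarith
  have nn: "0 \<le> a s * a t" using nonneg by simp
  show ?thesis
    unfolding eqs fps_mult_nth[of _ P]
  proof (rule sum_strict_mono_ex1)
    \<comment> \<open>Strictness comes from \<open>k = d\<close>, where the cofactor is the constant term \<open>1\<close> of \<open>P\<close>.\<close>
    show "\<exists>k\<in>{0..d}. fps_nth (bessel_fps (a s) * bessel_fps (a t)) k * fps_nth P (d - k) <
       fps_nth (bessel_fps \<mu> * bessel_fps (a s + a t - \<mu>)) k * fps_nth P (d - k)"
      using bessel_fps_mult_nth_strict_mono[of "a s" "a t" \<mu> "a s + a t - \<mu>" d] sum_pos nn prod_less P_0 \<open>2 \<le> d\<close>
      by (intro bexI[of _ d]) auto
    show "\<forall>k\<in>{0..d}. fps_nth (bessel_fps (a s) * bessel_fps (a t)) k * fps_nth P (d - k) \<le>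
       fps_nth (bessel_fps \<mu> * bessel_fps (a s + a t - \<mu>)) k * fps_nth P (d - k)"
      using sum_pos nn prod_less P_nonneg
      by (intro ballI mult_right_mono bessel_fps_mult_nth_mono) auto
  qed auto
qed

text \<open>Each smoothing step with \<open>\<mu>\<close> the mean lowers the number of values different from \<open>\<mu>\<close>.\<close>
lemma bessel_coeff_less_mean:
  fixes a :: "'a :: finite \<Rightarrow> real"
  assumes "\<And>t. 0 \<le> a t" "2 \<le> d" "(\<Sum>t\<in>UNIV. a t) = real CARD('a) * \<mu>" "\<exists>t. a t \<noteq> \<mu>"
  shows "bessel_coeff d a < bessel_coeff d (\<lambda>_ :: 'a. \<mu>)"
  using assms
proof (induction "card {t. a t \<noteq> \<mu>}" arbitrary: a rule: less_induct)
  case less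
  have "\<exists>s. a s < \<mu>"
  proof (rule ccontr)
    assume "\<nexists>s. a s < \<mu>"
    then have "\<exists>t\<in>UNIV. \<mu> < a t"
      using less.prems(4) by (metis UNIV_I linorder_neqE)
    with \<open>\<nexists>s. a s < \<mu>\<close> have "(\<Sum>t\<in>(UNIV :: 'a set). \<mu>) < (\<Sum>t\<in>UNIV. a t)"
      by (intro sum_strict_mono_ex1) (auto simp: not_less)
    with less.prems(3) show False by simp
  qed
  moreover have "\<exists>t. \<mu> < a t"
  proof (rule ccontr)
    assume "\<nexists>s. \<mu> < a s"
    then have "\<exists>t\<in>UNIV. a t < \<mu>"
      using less.prems(4) by (metis UNIV_I linorder_neqE)
    with \<open>\<nexists>s. \<mu> < a s\<close> have "(\<Sum>t\<in>UNIV. a t) < (\<Sum>t\<in>(UNIV :: 'a set). \<mu>)"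
      by (intro sum_strict_mono_ex1) (auto simp: not_less)
    with less.prems(3) show False by simp
  qed
  ultimately obtain s t where st: "a s < \<mu>" "\<mu> < a t" by blast
  then have "s \<noteq> t" by auto
  define a' where "a' = a(s := \<mu>, t := a s + a t - \<mu>)"
  have step: "bessel_coeff d a < bessel_coeff d a'"
    unfolding a'_def by (rule bessel_coeff_smoothing) (use less.prems st in auto)
  have nonneg': "0 \<le> a' u" for u
    using less.prems(1)[of u] less.prems(1)[of s] st by (auto simp: a'_def)
  have split: "(\<Sum>u\<in>UNIV. h u) = h s + h t + (\<Sum>u\<in>UNIV - {s, t}. h u)" for h :: "'a \<Rightarrow> real"
    using \<open>s \<noteq> t\<close> by (subst sum.subset_diff[of "{s, t}"]) auto
  have "(\<Sum>u\<in>UNIV - {s, t}. a' u) = (\<Sum>u\<in>UNIV - {s, t}. a u)"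
    by (intro sum.cong) (auto simp: a'_def)
  then have sum': "(\<Sum>u\<in>UNIV. a' u) = real CARD('a) * \<mu>"
    using less.prems(3) \<open>s \<noteq> t\<close> unfolding split by (simp add: a'_def)
  have smaller: "card {u. a' u \<noteq> \<mu>} < card {u. a u \<noteq> \<mu>}"
    using st \<open>s \<noteq> t\<close> by (intro psubset_card_mono) (auto simp: a'_def)
  show ?case
  proof (cases "\<exists>u. a' u \<noteq> \<mu>")
    case True
    from less.hyps[OF smaller nonneg' less.prems(2) sum' True] step show ?thesis by simp
  next
    case False
    then have "a' = (\<lambda>_. \<mu>)" by auto
    with step show ?thesis by simp
  qed
qed

section \<open>The sum over partitions\<close>

lemma card_permutations_of_multiset_real:
  assumes "finite S" "set_mset K \<subseteq> S"
  shows "real (card (permutations_of_multiset K)) = fact (size K) / (\<Prod>x\<in>S. fact (count K x))"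
proof -
  have "(\<Prod>x\<in>S. fact (count K x)) = (\<Prod>x\<in>set_mset K. fact (count K x) :: real)"
    using assms by (intro prod.mono_neutral_right) (auto simp: not_in_iff)
  moreover have "real (card (permutations_of_multiset K)) * (\<Prod>x\<in>set_mset K. fact (count K x)) = fact (size K)"
    using arg_cong[OF card_permutations_of_multiset_aux[of K], of real]
    by (simp only: of_nat_mult of_nat_prod of_nat_fact)
  ultimately show ?thesis by (simp add: field_simps)
qed

text \<open>
  Multisets of size \<open>d\<close> over a finite type, given by their multiplicities along a fixed
  enumeration \<open>ts\<close> of the type.
\<close>
lemma bij_betw_count_list:
  assumes "distinct ts" "set ts = (UNIV :: 'a :: finite set)"
  shows "bij_betw (\<lambda>M. map (count M) ts) (multisets_of_size UNIV d)
           {xs. length xs = CARD('a) \<and> sum_list xs = d}"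
proof (intro bij_betw_imageI inj_onI equalityI subsetI)
  fix M N assume "map (count M) ts = map (count N) ts"
  then show "M = N" using assms by (auto intro: multiset_eqI)
next
  have len: "length ts = CARD('a)" using assms distinct_card by metis
  have sum_ts: "sum_list (map h ts) = (\<Sum>t\<in>UNIV. h t)" for h :: "'a \<Rightarrow> nat"
    using assms by (metis sum_list_distinct_conv_sum_set)
  fix xs
  {
    assume "xs \<in> (\<lambda>M. map (count M) ts) ` multisets_of_size UNIV d"
    then show "xs \<in> {xs. length xs = CARD('a) \<and> sum_list xs = d}"
      by (auto simp: len sum_ts multisets_of_size_def simp flip: size_eq_sum_count)
  next
    assume xs: "xs \<in> {xs. length xs = CARD('a) \<and> sum_list xs = d}"
    define h where "h = (\<lambda>t. the (map_of (zip ts xs) t))"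
    have h: "map h ts = xs"
      using xs len assms by (intro nth_equalityI) (auto simp: h_def map_of_zip_nth)
    define M where "M = Abs_multiset h"
    have count: "count M = h" unfolding M_def by (rule count_Abs_multiset) simp
    have "size M = d"
      using xs h by (auto simp: size_eq_sum_count count simp flip: sum_ts)
    then show "xs \<in> (\<lambda>M. map (count M) ts) ` multisets_of_size UNIV d"
      using h by (intro image_eqI[of _ _ M]) (auto simp: multisets_of_size_def count)
  }
qed

text \<open>The parts of \<open>l\<close> as a multiset, filled up with zeros from \<open>d\<close> to \<open>q\<close> elements.\<close>
definition padded_parts :: "nat \<Rightarrow> nat \<Rightarrow> (nat \<Rightarrow> nat) \<Rightarrow> nat multiset" where
  "padded_parts q d l = mset (map l [1..<Suc d]) + replicate_mset (q - d) 0"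

lemma count_padded_parts: "count (padded_parts q d l) j = part_mult q d l j"
proof -
  have "count (mset (map l [1..<Suc d])) j = card {i \<in> {1..d}. l i = j}"
  proof (induction d)
    case (Suc d)
    have "{i \<in> {1..Suc d}. l i = j} = (if l (Suc d) = j then insert (Suc d) else id) {i \<in> {1..d}. l i = j}"
      by (auto simp: le_Suc_eq)
    with Suc show ?case by simp
  qed simp
  then show ?thesis by (auto simp: padded_parts_def part_mult_def)
qed

lemma sum_mset_padded_parts: "sum_mset (padded_parts q d l) = (\<Sum>i=1..d. l i)"
  by (simp add: padded_parts_def sum_unfold_sum_mset atLeastLessThanSuc_atLeastAtMost del: upt_Suc)

lemma sorted_rev_partition:
  assumes "l \<in> partitions d"
  shows "sorted (rev (map l [1..<Suc d]))"
  unfolding sorted_rev_iff_nth_mono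
  using assms by (auto simp: partitions_def monotone_on_def simp del: upt_Suc)

lemma bij_betw_padded_parts:
  assumes "d \<le> q"
  shows "bij_betw (padded_parts q d) (partitions d) {K. size K = q \<and> sum_mset K = d}"
proof (intro bij_betw_imageI inj_onI equalityI subsetI)
  fix l l' assume l: "l \<in> partitions d" "l' \<in> partitions d" "padded_parts q d l = padded_parts q d l'"
  then have "mset (rev (map l [1..<Suc d])) = mset (rev (map l' [1..<Suc d]))"
    by (simp add: padded_parts_def del: upt_Suc)
  with l have "rev (map l [1..<Suc d]) = rev (map l' [1..<Suc d])"
    by (metis properties_for_sort sorted_rev_partition)
  then have "\<forall>i\<in>{1..d}. l i = l' i" by (auto simp del: upt_Suc)
  with l show "l = l'" by (auto simp: partitions_def intro: PiE_ext)
next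
  fix K
  {
    assume "K \<in> padded_parts q d ` partitions d"
    then obtain l where l: "l \<in> partitions d" "K = padded_parts q d l" by auto
    then show "K \<in> {K. size K = q \<and> sum_mset K = d}"
      using assms by (simp add: sum_mset_padded_parts partitions_def) (simp add: padded_parts_def del: upt_Suc)
  next
    assume K: "K \<in> {K. size K = q \<and> sum_mset K = d}"
    \<comment> \<open>At most \<open>d\<close> parts are positive, so there are at least \<open>q - d\<close> zeros to remove.\<close>
    have "size (filter_mset (\<lambda>x. x \<noteq> 0) K) \<le> sum_mset (filter_mset (\<lambda>x. x \<noteq> 0) K)"
      by (induction K) auto
    also have "\<dots> = sum_mset K" by (induction K) auto
    finally have "size (filter_mset (\<lambda>x. x \<noteq> 0) K) \<le> d" using K by simp
    moreover have "size K = count K 0 + size (filter_mset (\<lambda>x. x \<noteq> 0) K)"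
      by (induction K) auto
    ultimately have "q - d \<le> count K 0" using K by auto
    then have sub: "replicate_mset (q - d) 0 \<subseteq># K"
      by (simp add: count_le_replicate_mset_subset_eq)
    define ys where "ys = rev (sorted_list_of_multiset (K - replicate_mset (q - d) 0))"
    have ys: "mset ys = K - replicate_mset (q - d) 0" by (simp add: ys_def)
    have "size (mset ys) = d"
      unfolding ys using K sub assms by (simp add: size_Diff_submset)
    then have len: "length ys = d" by simp
    have srt: "sorted (rev ys)" by (simp add: ys_def)
    define l where "l = (\<lambda>i\<in>{1..d}. ys ! (i - 1))"
    have map_l: "map l [1..<Suc d] = ys"
      using len by (intro nth_equalityI) (auto simp: l_def simp del: upt_Suc)
    have K_eq: "K = padded_parts q d l"
      unfolding padded_parts_def map_l ys using sub by simp
    have "(\<Sum>i=1..d. l i) = d"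
      using K unfolding K_eq by (simp add: sum_mset_padded_parts)
    moreover have "antimono_on {1..d} l"
      using srt len unfolding sorted_rev_iff_nth_mono by (auto simp: monotone_on_def l_def diff_le_mono)
    ultimately have "l \<in> partitions d"
      by (auto simp: partitions_def l_def)
    with K_eq show "K \<in> padded_parts q d ` partitions d" by blast
  }
qed

text \<open>
  The multisets \<open>M\<close> of size \<open>d\<close> are grouped by the multiset of all their multiplicities, which is a
  padded partition of \<open>d\<close>; the number of \<open>M\<close> in one group is a number of permutations of a multiset,
  hence the multinomial coefficient over \<open>part_mult\<close>.
\<close>
lemma fact_sq_bessel_coeff_one:
  assumes "d \<le> CARD('a)"
  shows "(fact d)\<^sup>2 * bessel_coeff d (\<lambda>_ :: 'a :: finite. 1) =
    (\<Sum>l\<in>partitions d. (multinomial d {1..d} l)\<^sup>2 * multinomial CARD('a) {0..d} (part_mult CARD('a) d l))"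
proof -
  define q where "q = CARD('a)"
  define X where "X = {xs :: nat list. length xs = q \<and> sum_list xs = d}"
  define w :: "nat multiset \<Rightarrow> real" where "w K = (\<Prod>x\<in>#K. 1 / (fact x)\<^sup>2)" for K
  obtain ts where ts: "distinct ts" "set ts = (UNIV :: 'a set)"
    using finite_distinct_list[of "UNIV :: 'a set"] by auto
  have bij: "bij_betw (\<lambda>M. map (count M) ts) (multisets_of_size UNIV d) X"
    unfolding X_def q_def by (rule bij_betw_count_list[OF ts])
  have "finite X"
    using bij_betw_finite[OF bij] finite_multisets_of_size[of "UNIV :: 'a set" d] by simp
  have "bessel_coeff d (\<lambda>_ :: 'a. 1) = (\<Sum>M\<in>multisets_of_size UNIV d. w (mset (map (count M) ts)))"
    unfolding bessel_coeff_eq_sum w_def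
  proof (intro sum.cong refl)
    fix M :: "'a multiset"
    have "(\<Prod>t\<in>UNIV. 1 / (fact (count M t))\<^sup>2 :: real) = (\<Prod>t\<leftarrow>ts. 1 / (fact (count M t))\<^sup>2)"
      using ts by (metis prod.distinct_set_conv_list)
    then show "(\<Prod>t\<in>UNIV. 1 ^ count M t / (fact (count M t))\<^sup>2 :: real) =
       (\<Prod>x\<in>#mset (map (count M) ts). 1 / (fact x)\<^sup>2)"
      by (simp add: prod_mset_prod_list o_def flip: mset_map)
  qed
  also have "\<dots> = (\<Sum>xs\<in>X. w (mset xs))"
    by (rule sum.reindex_bij_betw[OF bij])
  also have "\<dots> = (\<Sum>K\<in>mset ` X. \<Sum>xs | xs \<in> X \<and> mset xs = K. w (mset xs))"
    by (rule sum.image_gen[OF \<open>finite X\<close>])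
  also have "mset ` X = {K. size K = q \<and> sum_mset K = d}"
  proof (intro equalityI subsetI)
    fix K assume "K \<in> {K. size K = q \<and> sum_mset K = d}"
    moreover obtain xs where "mset xs = K" using ex_mset by blast
    ultimately show "K \<in> mset ` X"
      by (intro image_eqI[of _ _ xs]) (auto simp: X_def sum_mset_sum_list)
  qed (auto simp: X_def sum_mset_sum_list)
  also have "(\<Sum>K | size K = q \<and> sum_mset K = d. \<Sum>xs | xs \<in> X \<and> mset xs = K. w (mset xs)) =
      (\<Sum>K | size K = q \<and> sum_mset K = d. w K * real (card (permutations_of_multiset K)))"
  proof (intro sum.cong refl)
    fix K assume "K \<in> {K. size K = q \<and> sum_mset K = d}"
    then have "{xs. xs \<in> X \<and> mset xs = K} = permutations_of_multiset K"
      by (auto simp: X_def permutations_of_multiset_def sum_mset_sum_list)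
    moreover have "(\<Sum>xs\<in>permutations_of_multiset K. w (mset xs)) = (\<Sum>xs\<in>permutations_of_multiset K. w K)"
      by (intro sum.cong) (auto simp: permutations_of_multiset_def)
    ultimately show "(\<Sum>xs | xs \<in> X \<and> mset xs = K. w (mset xs)) = w K * real (card (permutations_of_multiset K))"
      by simp
  qed
  also have "\<dots> = (\<Sum>l\<in>partitions d. w (padded_parts q d l) * real (card (permutations_of_multiset (padded_parts q d l))))"
    using assms by (intro sum.reindex_bij_betw[symmetric] bij_betw_padded_parts) (simp add: q_def)
  finally have "(fact d)\<^sup>2 * bessel_coeff d (\<lambda>_ :: 'a. 1) =
    (\<Sum>l\<in>partitions d. (fact d)\<^sup>2 * (w (padded_parts q d l) * real (card (permutations_of_multiset (padded_parts q d l)))))"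
    by (simp add: sum_distrib_left)
  also have "\<dots> = (\<Sum>l\<in>partitions d. (multinomial d {1..d} l)\<^sup>2 * multinomial q {0..d} (part_mult q d l))"
  proof (intro sum.cong refl)
    fix l assume l: "l \<in> partitions d"
    have "l i \<le> d" if "i \<in> {1..d}" for i
      using member_le_sum[of i "{1..d}" l] that l by (auto simp: partitions_def)
    then have sub: "set_mset (padded_parts q d l) \<subseteq> {0..d}"
      by (auto simp: padded_parts_def split: if_splits simp del: upt_Suc)
    have size: "size (padded_parts q d l) = q"
      using assms by (simp add: padded_parts_def q_def del: upt_Suc)
    have "w (padded_parts q d l) = (\<Prod>i\<leftarrow>[1..<Suc d]. 1 / (fact (l i))\<^sup>2)"
      by (simp add: w_def padded_parts_def prod_mset_prod_list o_def del: upt_Suc flip: mset_map)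
    also have "\<dots> = (\<Prod>i=1..d. 1 / (fact (l i))\<^sup>2)"
      by (subst prod.distinct_set_conv_list[symmetric])
        (auto simp: atLeastLessThanSuc_atLeastAtMost simp del: upt_Suc)
    finally have "(fact d)\<^sup>2 * w (padded_parts q d l) = (multinomial d {1..d} l)\<^sup>2"
      by (simp add: multinomial_def power_divide prod_dividef prod_power_distrib)
    moreover have "real (card (permutations_of_multiset (padded_parts q d l))) = multinomial q {0..d} (part_mult q d l)"
      by (subst card_permutations_of_multiset_real[OF _ sub])
        (simp_all add: multinomial_def size count_padded_parts)
    ultimately show "(fact d)\<^sup>2 * (w (padded_parts q d l) * real (card (permutations_of_multiset (padded_parts q d l)))) =
      (multinomial d {1..d} l)\<^sup>2 * multinomial q {0..d} (part_mult q d l)"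
      by (metis mult.assoc)
  qed
  finally show ?thesis by (simp add: q_def)
qed

section \<open>Power sums determine a multiset\<close>

text \<open>
  Newton's identities in generating form: the logarithmic derivative of \<open>\<Prod>t. (1 - tX)\<close> is minus the
  generating series of the power sums.
\<close>
lemma fps_deriv_prod_mset_linear:
  fixes M :: "'a :: comm_ring_1 multiset"
  shows "fps_deriv (\<Prod>t\<in>#M. 1 - fps_const t * fps_X) =
    - ((\<Prod>t\<in>#M. 1 - fps_const t * fps_X) * Abs_fps (\<lambda>k. \<Sum>t\<in>#M. t ^ Suc k))"
proof (induction M)
  case empty
  show ?case by (simp add: fps_eq_iff)
next
  case (add t M)
  define P where "P = (\<Prod>t\<in>#M. 1 - fps_const t * fps_X)"
  define S where "S = Abs_fps (\<lambda>k. \<Sum>t\<in>#M. t ^ Suc k)"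
  define G where "G = Abs_fps (\<lambda>k. t ^ Suc k)"
  have G: "(1 - fps_const t * fps_X) * G = fps_const t"
  proof (rule fps_ext)
    fix k show "fps_nth ((1 - fps_const t * fps_X) * G) k = fps_nth (fps_const t) k"
      by (cases k) (simp_all add: G_def algebra_simps)
  qed
  have "fps_deriv ((1 - fps_const t * fps_X) * P) = - (P * fps_const t) - (1 - fps_const t * fps_X) * P * S"
    using add.IH unfolding P_def[symmetric] S_def[symmetric] by (simp add: algebra_simps)
  also have "\<dots> = - ((1 - fps_const t * fps_X) * P * (G + S))"
  proof -
    have "P * fps_const t = P * ((1 - fps_const t * fps_X) * G)" by (simp only: G)
    then show ?thesis by (simp add: algebra_simps)
  qed
  also have "G + S = Abs_fps (\<lambda>k. \<Sum>t\<in>#add_mset t M. t ^ Suc k)"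
    by (rule fps_ext) (simp add: G_def S_def)
  finally show ?case by (simp add: P_def)
qed

text \<open>
  Newton's identities determine the coefficients of \<open>\<Prod>t. (1 - tX)\<close> up to degree \<open>d\<close>, because \<open>1, \<dots>, d\<close>
  are invertible. These are the coefficients of \<open>\<Prod>t. (X - t)\<close> in reverse order, so the roots and
  their multiplicities are determined.
\<close>
lemma multiset_eq_if_power_sums_eq:
  fixes M N :: "'a :: field multiset"
  assumes size: "size M = d" "size N = d"
    and power_sums: "\<And>k. 1 \<le> k \<Longrightarrow> k \<le> d \<Longrightarrow> (\<Sum>t\<in>#M. t ^ k) = (\<Sum>t\<in>#N. t ^ k)"
    and inv: "\<And>k. 1 \<le> k \<Longrightarrow> k \<le> d \<Longrightarrow> (of_nat k :: 'a) \<noteq> 0"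
  shows "M = N"
proof -
  define P where "P = (\<lambda>M :: 'a multiset. \<Prod>t\<in>#M. 1 - fps_const t * fps_X)"
  have P_0: "fps_nth (P M) 0 = 1" for M
    unfolding P_def by (induction M) auto
  have rec: "of_nat (Suc k) * fps_nth (P M) (Suc k) =
     - (\<Sum>i=0..k. fps_nth (P M) i * (\<Sum>t\<in>#M. t ^ Suc (k - i)))" for M k
  proof -
    have "of_nat (Suc k) * fps_nth (P M) (Suc k) = fps_nth (fps_deriv (P M)) k" by simp
    also have "\<dots> = - (\<Sum>i=0..k. fps_nth (P M) i * (\<Sum>t\<in>#M. t ^ Suc (k - i)))"
      unfolding P_def fps_deriv_prod_mset_linear by (simp add: fps_mult_nth)
    finally show ?thesis .
  qed
  have coeffs: "fps_nth (P M) k = fps_nth (P N) k" if "k \<le> d" for k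
    using that
  proof (induction k rule: less_induct)
    case (less k)
    show ?case
    proof (cases k)
      case (Suc j)
      have "(\<Sum>i=0..j. fps_nth (P M) i * (\<Sum>t\<in>#M. t ^ Suc (j - i))) =
        (\<Sum>i=0..j. fps_nth (P N) i * (\<Sum>t\<in>#N. t ^ Suc (j - i)))"
        using less Suc by (intro sum.cong refl arg_cong2[of _ _ _ _ "(*)"] power_sums) auto
      then have "of_nat (Suc j) * fps_nth (P M) (Suc j) = of_nat (Suc j) * fps_nth (P N) (Suc j)"
        unfolding rec by simp
      with inv[of "Suc j"] less.prems Suc show ?thesis by (simp del: of_nat_Suc)
    qed (simp add: P_0)
  qed
  define R where "R = (\<lambda>M :: 'a multiset. \<Prod>t\<in>#M. [:-t, 1:])"
  have degree_R: "degree (R M) = size M" and R_nz: "R M \<noteq> 0" for M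
    unfolding R_def by (induction M) (auto simp: degree_mult_eq simp del: mult_pCons_left)
  have reflect_linear: "reflect_poly [:-t, 1:] = [:1, -t:]" for t :: 'a
    by (simp add: reflect_poly_def)
  have fps_linear: "fps_of_poly [:1, -t:] = 1 - fps_const t * fps_X" for t :: 'a
    by (simp add: fps_of_poly_pCons mult.commute flip: fps_const_neg)
  have P_R: "P M = fps_of_poly (reflect_poly (R M))" for M
    unfolding P_def R_def
    by (induction M)
      (simp_all add: reflect_poly_mult reflect_linear fps_of_poly_mult fps_linear del: mult_pCons_left mult_pCons_right)
  have "R M = R N"
  proof (rule poly_eqI)
    fix i
    show "poly.coeff (R M) i = poly.coeff (R N) i"
    proof (cases "i \<le> d")
      case True
      then show ?thesis
        using coeffs[of "d - i"] size by (simp add: P_R coeff_reflect_poly degree_R split: if_splits)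
    qed (simp add: coeff_eq_0 degree_R size)
  qed
  moreover have "proots (R M) = M" for M
    using R_nz unfolding R_def by (induction M) (auto simp: proots_mult simp del: mult_pCons_left)
  ultimately show ?thesis by metis
qed

section \<open>Additive characters of a finite field\<close>

lemma finite_field_exponent_nonzero:
  assumes "CARD('a :: finite_field) = p ^ n"
  shows "n \<noteq> 0"
proof
  assume "n = 0"
  then have "card (UNIV :: 'a set) = 1" using assms by simp
  then show False by (metis card_1_singletonE UNIV_I singletonD zero_neq_one)
qed

lemma field_trace_add:
  fixes x y :: "'a :: finite_field"
  assumes "prime p" "CARD('a) = p ^ n"
  shows "field_trace p n (x + y) = field_trace p n x + field_trace p n y"
proof -
  have "(x + y) ^ (p ^ i) = x ^ (p ^ i) + y ^ (p ^ i)" for i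
    by (rule freshmans_dream') (simp_all add: char_eq_of_card[OF assms] assms)
  then show ?thesis by (simp add: field_trace_def sum.distrib)
qed

lemma prime_residue_trace:
  fixes y :: "'a :: finite_field"
  assumes "prime p" "CARD('a) = p ^ n"
  shows "prime_residue p (field_trace p n y) < p"
    and "of_nat (prime_residue p (field_trace p n y)) = field_trace p n y"
  using theI'[OF ex1_trace_residue[OF assms, of y]] by (auto simp: prime_residue_def)

lemma add_char_add:
  fixes x y :: "'a :: finite_field"
  assumes "prime p" "CARD('a) = p ^ n"
  shows "add_char p n (x + y) = add_char p n x * add_char p n y"
proof -
  define r where "r = (\<lambda>y :: 'a. prime_residue p (field_trace p n y))"
  define z where "z = exp (2 * of_real pi * \<i> / of_nat p)"
  have "p > 0" using assms(1) by (rule prime_gt_0_nat)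
  have char: "add_char p n y = z ^ r y" for y :: 'a
    unfolding add_char_def z_def r_def exp_of_nat_mult[symmetric] by (simp add: mult_ac)
  have "z ^ p = 1"
    unfolding z_def exp_of_nat_mult[symmetric] using \<open>p > 0\<close> by simp
  then have z_mod: "z ^ k = z ^ (k mod p)" for k
    by (metis mult_div_mod_eq power_add power_mult power_one mult_1)
  have "of_nat (r y) = field_trace p n y" for y
    unfolding r_def by (rule prime_residue_trace(2)[OF assms])
  then have "(of_nat (r (x + y)) :: 'a) = of_nat (r x + r y)"
    by (simp only: of_nat_add field_trace_add[OF assms])
  then have "[r (x + y) = r x + r y] (mod p)"
    by (simp only: of_nat_eq_iff_cong_CHAR char_eq_of_card[OF assms])
  then have "z ^ r (x + y) = z ^ (r x + r y)"
    unfolding cong_def by (metis z_mod)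
  then show ?thesis by (simp add: char power_add)
qed

lemma norm_add_char [simp]: "cmod (add_char p n y) = 1"
  by (simp add: add_char_def)

lemma add_char_0:
  assumes "prime p" "CARD('a :: finite_field) = p ^ n"
  shows "add_char p n (0 :: 'a) = 1"
  using add_char_add[OF assms, of 0 0] norm_add_char[of p n "0 :: 'a"]
  by (auto simp del: norm_add_char)

lemma add_char_sum:
  assumes "prime p" "CARD('a :: finite_field) = p ^ n" "finite A"
  shows "add_char p n (\<Sum>i\<in>A. g i :: 'a) = (\<Prod>i\<in>A. add_char p n (g i))"
  using assms(3) by induction (simp_all add: add_char_0[OF assms(1,2)] add_char_add[OF assms(1,2)])

lemma add_char_minus:
  fixes y :: "'a :: finite_field"
  assumes "prime p" "CARD('a) = p ^ n"
  shows "add_char p n (- y) = cnj (add_char p n y)"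
proof -
  have "add_char p n y * add_char p n (- y) = 1"
    using add_char_add[OF assms, of y "- y"] add_char_0[OF assms] by simp
  moreover have "add_char p n y * cnj (add_char p n y) = 1"
    by (simp add: complex_norm_square[symmetric])
  ultimately show ?thesis by (metis mult_cancel_left mult_zero_left zero_neq_one)
qed

text \<open>
  The trace is a polynomial function of degree \<open>p\<^bsup>n - 1\<^esup> < q\<close>, so it does not vanish everywhere.
\<close>
lemma add_char_nontrivial:
  assumes p: "prime p" and card: "CARD('a :: finite_field) = p ^ n"
  shows "\<exists>y :: 'a. add_char p n y \<noteq> 1"
proof -
  have "p > 1" using p by (rule prime_gt_1_nat)
  have "n \<noteq> 0" using card by (rule finite_field_exponent_nonzero)
  then obtain m where n: "n = Suc m" by (cases n) auto
  define T where "T = (\<Sum>i<n. Polynomial.monom (1 :: 'a) (p ^ i))"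
  have poly_T: "poly T y = field_trace p n y" for y
    by (simp add: T_def poly_sum poly_monom field_trace_def)
  have "poly.coeff T (p ^ m) = (\<Sum>i<n. if i = m then 1 else 0)"
    unfolding T_def coeff_sum using \<open>p > 1\<close> by (intro sum.cong) auto
  then have "T \<noteq> 0" using n by auto
  have "degree T \<le> p ^ m"
    unfolding T_def using \<open>p > 1\<close> n
    by (intro degree_sum_le order.trans[OF degree_monom_le] power_increasing) auto
  have "\<exists>y. poly T y \<noteq> 0"
  proof (rule ccontr)
    assume "\<nexists>y. poly T y \<noteq> 0"
    then have "CARD('a) \<le> p ^ m"
      using card_poly_roots_bound[OF \<open>T \<noteq> 0\<close>] \<open>degree T \<le> p ^ m\<close> by simp
    then show False using \<open>p > 1\<close> by (simp add: card n)
  qed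
  then obtain y :: 'a where y: "field_trace p n y \<noteq> 0" by (auto simp: poly_T)
  define r where "r = prime_residue p (field_trace p n y)"
  have "r < p" "r \<noteq> 0"
    using prime_residue_trace[OF p card, of y] y unfolding r_def by (metis of_nat_0)+
  then have "\<not> p dvd r" by (auto dest: dvd_imp_le)
  then have "add_char p n y \<noteq> 1"
    using complex_root_unity_eq_1[of p r] \<open>p > 1\<close> by (simp add: add_char_def r_def)
  then show ?thesis ..
qed

lemma sum_add_char_mult:
  fixes u :: "'a :: finite_field"
  assumes "prime p" "CARD('a) = p ^ n"
  shows "(\<Sum>y\<in>UNIV. add_char p n (y * u)) = (if u = 0 then of_nat CARD('a) else 0)"
proof (cases "u = 0")
  case False
  obtain y0 :: 'a where y0: "add_char p n y0 \<noteq> 1"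
    using add_char_nontrivial[OF assms] by auto
  have "(\<Sum>y\<in>UNIV. add_char p n (y * u)) = (\<Sum>y\<in>UNIV. add_char p n ((y + y0 / u) * u))"
    by (rule sum.reindex_bij_witness[of _ "\<lambda>y. y + y0 / u" "\<lambda>y. y - y0 / u"]) auto
  also have "\<dots> = add_char p n y0 * (\<Sum>y\<in>UNIV. add_char p n (y * u))"
    using False by (simp add: ring_distribs add_char_add[OF assms] sum_distrib_left mult_ac)
  finally show ?thesis using y0 False by simp
qed (simp add: add_char_0[OF assms])

lemma sum_vec_space_add_char_dot:
  fixes v :: "nat \<Rightarrow> 'a :: finite_field"
  assumes "prime p" "CARD('a) = p ^ n"
  shows "(\<Sum>x\<in>vec_space d. add_char p n (dot d x v)) =
    (if \<forall>i\<in>{1..d}. v i = 0 then of_nat CARD('a) ^ d else 0)"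
proof -
  have "(\<Sum>x\<in>vec_space d. add_char p n (dot d x v)) =
        (\<Sum>x\<in>{1..d} \<rightarrow>\<^sub>E UNIV. \<Prod>i=1..d. add_char p n (x i * v i))"
    by (simp add: vec_space_def dot_def add_char_sum[OF assms])
  also have "\<dots> = (\<Prod>i=1..d. \<Sum>y\<in>UNIV. add_char p n (y * v i))"
    by (rule prod_sum_PiE[symmetric]) auto
  also have "\<dots> = (if \<forall>i\<in>{1..d}. v i = 0 then of_nat CARD('a) ^ d else 0)"
    by (auto simp: sum_add_char_mult[OF assms])
  finally show ?thesis .
qed

section \<open>Moments of the extension operator\<close>

text \<open>The point of the moment curve with parameter \<open>t\<close>.\<close>
definition curve_point :: "nat \<Rightarrow> 'a :: finite_field \<Rightarrow> nat \<Rightarrow> 'a" where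
  "curve_point d t = (\<lambda>i\<in>{1..d}. t ^ i)"

lemma moment_curve_eq: "moment_curve d = range (curve_point d)"
  by (simp add: moment_curve_def curve_point_def)

lemma inj_curve_point:
  assumes "1 \<le> d" shows "inj (curve_point d)"
proof (rule injI)
  fix s t :: 'a assume "curve_point d s = curve_point d t"
  then have "curve_point d s 1 = curve_point d t 1" by simp
  then show "s = t" using assms by (simp add: curve_point_def)
qed

lemma sum_moment_curve:
  assumes "1 \<le> d"
  shows "(\<Sum>\<xi>\<in>moment_curve d. h \<xi>) = (\<Sum>t\<in>UNIV. h (curve_point d t))"
  unfolding moment_curve_eq by (subst sum.reindex[OF inj_curve_point[OF assms]]) simp

lemma finite_lists_of_length: "finite {w :: 'a :: finite list. length w = k}"
  using finite_lists_length_eq[of "UNIV :: 'a set" k] by simp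

lemma sum_power_eq_sum_lists:
  fixes g :: "'a :: finite \<Rightarrow> 'b :: comm_semiring_1"
  shows "(\<Sum>t\<in>UNIV. g t) ^ k = (\<Sum>w | length w = k. \<Prod>t\<leftarrow>w. g t)"
proof (induction k)
  case 0
  have "{w :: 'a list. length w = 0} = {[]}" by auto
  then show ?case by simp
next
  case (Suc k)
  have "(\<Sum>w | length w = Suc k. \<Prod>t\<leftarrow>w. g t) =
        (\<Sum>(t, w)\<in>UNIV \<times> {w. length w = k}. g t * (\<Prod>t\<leftarrow>w. g t))"
    by (rule sum.reindex_bij_witness[of _ "\<lambda>(t, w). t # w" "\<lambda>w. (hd w, tl w)"])
      (auto simp: length_Suc_conv)
  also have "\<dots> = (\<Sum>t\<in>UNIV. g t) * (\<Sum>w | length w = k. \<Prod>t\<leftarrow>w. g t)"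
    by (simp add: sum_product sum.cartesian_product)
  finally show ?case using Suc by simp
qed

lemma prod_list_add_char:
  assumes "prime p" "CARD('a :: finite_field) = p ^ n"
  shows "(\<Prod>t\<leftarrow>w. F t * add_char p n (dot d x (curve_point d t))) =
    (\<Prod>t\<leftarrow>w. F t) * add_char p n (dot d x (\<lambda>i. \<Sum>t\<leftarrow>w. (t :: 'a) ^ i))"
proof (induction w)
  case Nil
  show ?case by (simp add: dot_def add_char_0[OF assms])
next
  case (Cons t w)
  have "dot d x (\<lambda>i. \<Sum>t\<leftarrow>t # w. t ^ i) = dot d x (curve_point d t) + dot d x (\<lambda>i. \<Sum>t\<leftarrow>w. t ^ i)"
    by (simp add: dot_def curve_point_def ring_distribs sum.distrib)
  with Cons show ?case by (simp add: add_char_add[OF assms] mult_ac)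
qed

lemma dot_diff: "dot d x (\<lambda>i. u i - v i) = dot d x u + - dot d x v"
  by (simp add: dot_def ring_distribs sum_subtractf)

text \<open>
  The \<open>d\<close>-th power of the extension is a sum over words \<open>w\<close> of length \<open>d\<close>. By orthogonality of the
  characters only pairs of words with equal power sums survive in the sum of its squared modulus,
  and these are the pairs of arrangements of the same multiset.
\<close>
lemma sum_norm_extension_op:
  fixes f :: "(nat \<Rightarrow> 'a :: finite_field) \<Rightarrow> complex"
  assumes p: "prime p" and card: "CARD('a) = p ^ n" and d: "1 \<le> d" "d < p"
  shows "(\<Sum>x\<in>vec_space d. cmod (extension_op p n d f x) ^ (2 * d)) =
    (fact d)\<^sup>2 / real CARD('a) ^ d * bessel_coeff d (\<lambda>t. (cmod (f (curve_point d t)))\<^sup>2)"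
proof -
  define q where "q = CARD('a)"
  have "q > 0" by (simp add: q_def)
  define F where "F = (\<lambda>t. f (curve_point d t))"
  define W where "W = {w :: 'a list. length w = d}"
  define PF where "PF = (\<lambda>w. \<Prod>t\<leftarrow>w. F t)"
  define ps where "ps = (\<lambda>w i. \<Sum>t\<leftarrow>w. (t :: 'a) ^ i)"
  have "finite W" unfolding W_def by (rule finite_lists_of_length)
  have ext_pow: "extension_op p n d f x ^ d = 1 / of_nat q ^ d * (\<Sum>w\<in>W. PF w * add_char p n (dot d x (ps w)))" for x
    by (simp add: extension_op_def sum_moment_curve[OF d(1)] power_divide sum_power_eq_sum_lists
        prod_list_add_char[OF p card] W_def PF_def ps_def F_def q_def)
  have ps_iff: "(\<forall>i\<in>{1..d}. ps w i - ps w' i = 0) \<longleftrightarrow> mset w = mset w'" if "w \<in> W" "w' \<in> W" for w w'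
  proof
    assume eq: "\<forall>i\<in>{1..d}. ps w i - ps w' i = 0"
    show "mset w = mset w'"
    proof (rule multiset_eq_if_power_sums_eq)
      fix k assume k: "1 \<le> k" "k \<le> d"
      show "(\<Sum>t\<in>#mset w. t ^ k) = (\<Sum>t\<in>#mset w'. t ^ k)"
        using eq k by (simp add: ps_def sum_mset_sum_list flip: mset_map)
      show "(of_nat k :: 'a) \<noteq> 0"
        using k d by (auto simp: of_nat_eq_0_iff_char_dvd char_eq_of_card[OF p card] dest: dvd_imp_le)
    qed (use that in \<open>auto simp: W_def\<close>)
  next
    assume "mset w = mset w'"
    then have "ps w i = ps w' i" for i
      unfolding ps_def by (metis mset_map sum_mset_sum_list)
    then show "\<forall>i\<in>{1..d}. ps w i - ps w' i = 0" by simp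
  qed
  have PF_mset: "PF w = (\<Prod>t\<in>#mset w. F t)" for w
    by (simp add: PF_def prod_mset_prod_list flip: mset_map)
  have "complex_of_real (\<Sum>x\<in>vec_space d. cmod (extension_op p n d f x) ^ (2 * d)) =
    (\<Sum>x\<in>vec_space d. extension_op p n d f x ^ d * cnj (extension_op p n d f x ^ d))"
    unfolding of_real_sum
  proof (intro sum.cong refl)
    fix x
    have "cmod (extension_op p n d f x) ^ (2 * d) = (cmod (extension_op p n d f x ^ d))\<^sup>2"
      by (simp add: norm_power mult.commute flip: power_mult)
    then show "complex_of_real (cmod (extension_op p n d f x) ^ (2 * d)) =
        extension_op p n d f x ^ d * cnj (extension_op p n d f x ^ d)"
      by (simp only: complex_norm_square)
  qed
  also have "\<dots> = (\<Sum>x\<in>vec_space d. \<Sum>w\<in>W. \<Sum>w'\<in>W. 1 / of_nat q ^ (2 * d) * (PF w * cnj (PF w')) *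
      add_char p n (dot d x (\<lambda>i. ps w i - ps w' i)))"
    unfolding ext_pow dot_diff add_char_add[OF p card] add_char_minus[OF p card]
    by (simp add: sum_product sum_divide_distrib mult_2 mult_2_right power_add mult_ac)
  also have "\<dots> = (\<Sum>w\<in>W. \<Sum>w'\<in>W. 1 / of_nat q ^ (2 * d) * (PF w * cnj (PF w')) *
      (\<Sum>x\<in>vec_space d. add_char p n (dot d x (\<lambda>i. ps w i - ps w' i))))"
    unfolding sum_distrib_left by (subst sum.swap, rule sum.cong, rule refl, rule sum.swap)
  also have "\<dots> = (\<Sum>w\<in>W. \<Sum>w'\<in>W. if mset w = mset w' then 1 / of_nat q ^ d * (PF w * cnj (PF w')) else 0)"
    using \<open>q > 0\<close> unfolding sum_vec_space_add_char_dot[OF p card] q_def[symmetric]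
    by (intro sum.cong refl) (simp only: ps_iff, simp add: mult_2 power_add)
  also have "\<dots> = (\<Sum>w\<in>W. 1 / of_nat q ^ d * of_nat (card (permutations_of_multiset (mset w))) *
      of_real (\<Prod>t\<in>#mset w. (cmod (F t))\<^sup>2))"
  proof (intro sum.cong refl)
    fix w assume "w \<in> W"
    have perms: "{w' \<in> W. mset w = mset w'} = permutations_of_multiset (mset w)"
      using \<open>w \<in> W\<close> by (auto simp: W_def permutations_of_multiset_def dest: mset_eq_length)
    have "PF w * cnj (PF w') = of_real (\<Prod>t\<in>#mset w. (cmod (F t))\<^sup>2)" if "mset w = mset w'" for w'
    proof -
      have "PF w' = PF w" using that by (simp add: PF_mset)
      moreover have "PF w * cnj (PF w) = of_real (\<Prod>t\<in>#mset w. (cmod (F t))\<^sup>2)"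
        unfolding PF_def by (induction w) (simp_all add: complex_norm_square mult_ac del: of_real_power)
      ultimately show ?thesis by simp
    qed
    then have "(\<Sum>w'\<in>W. if mset w = mset w' then 1 / of_nat q ^ d * (PF w * cnj (PF w')) else 0) =
      (\<Sum>w'\<in>W. if mset w = mset w' then 1 / of_nat q ^ d * of_real (\<Prod>t\<in>#mset w. (cmod (F t))\<^sup>2) else 0)"
      by (intro sum.cong) auto
    also have "\<dots> = (\<Sum>w' | w' \<in> W \<and> mset w = mset w'. 1 / of_nat q ^ d * of_real (\<Prod>t\<in>#mset w. (cmod (F t))\<^sup>2))"
      by (rule sum.inter_filter[OF \<open>finite W\<close>, symmetric])
    finally show "(\<Sum>w'\<in>W. if mset w = mset w' then 1 / of_nat q ^ d * (PF w * cnj (PF w')) else 0) =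
      1 / of_nat q ^ d * of_nat (card (permutations_of_multiset (mset w))) * of_real (\<Prod>t\<in>#mset w. (cmod (F t))\<^sup>2)"
      by (simp add: perms)
  qed
  also have "\<dots> = of_real (\<Sum>w\<in>W. 1 / real q ^ d * real (card (permutations_of_multiset (mset w))) *
      (\<Prod>t\<in>#mset w. (cmod (F t))\<^sup>2))"
    by simp
  finally have "(\<Sum>x\<in>vec_space d. cmod (extension_op p n d f x) ^ (2 * d)) =
    (\<Sum>w\<in>W. 1 / real q ^ d * real (card (permutations_of_multiset (mset w))) * (\<Prod>t\<in>#mset w. (cmod (F t))\<^sup>2))"
    by (simp only: of_real_eq_iff)
  also have "\<dots> = (\<Sum>M\<in>mset ` W. \<Sum>w | w \<in> W \<and> mset w = M.
      1 / real q ^ d * real (card (permutations_of_multiset (mset w))) * (\<Prod>t\<in>#mset w. (cmod (F t))\<^sup>2))"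
    by (rule sum.image_gen[OF \<open>finite W\<close>])
  also have "mset ` W = multisets_of_size UNIV d"
  proof (intro equalityI subsetI)
    fix M :: "'a multiset" assume "M \<in> multisets_of_size UNIV d"
    moreover obtain w where "mset w = M" using ex_mset by blast
    ultimately show "M \<in> mset ` W"
      by (intro image_eqI[of _ _ w]) (auto simp: W_def multisets_of_size_def)
  qed (auto simp: W_def multisets_of_size_def)
  also have "(\<Sum>M\<in>multisets_of_size UNIV d. \<Sum>w | w \<in> W \<and> mset w = M.
      1 / real q ^ d * real (card (permutations_of_multiset (mset w))) * (\<Prod>t\<in>#mset w. (cmod (F t))\<^sup>2)) =
    (\<Sum>M\<in>multisets_of_size UNIV d. (fact d)\<^sup>2 / real q ^ d *
      (\<Prod>t\<in>UNIV. ((cmod (F t))\<^sup>2) ^ count M t / (fact (count M t))\<^sup>2))"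
  proof (intro sum.cong refl)
    fix M :: "'a multiset" assume M: "M \<in> multisets_of_size UNIV d"
    have perms: "{w. w \<in> W \<and> mset w = M} = permutations_of_multiset M"
      using M by (auto simp: W_def permutations_of_multiset_def multisets_of_size_def)
    have "(\<Sum>w | w \<in> W \<and> mset w = M.
      1 / real q ^ d * real (card (permutations_of_multiset (mset w))) * (\<Prod>t\<in>#mset w. (cmod (F t))\<^sup>2)) =
      (\<Sum>w\<in>permutations_of_multiset M. 1 / real q ^ d * real (card (permutations_of_multiset M)) * (\<Prod>t\<in>#M. (cmod (F t))\<^sup>2))"
      unfolding perms by (intro sum.cong) (auto simp: permutations_of_multiset_def)
    also have "\<dots> = 1 / real q ^ d * (real (card (permutations_of_multiset M)))\<^sup>2 * (\<Prod>t\<in>#M. (cmod (F t))\<^sup>2)"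
      by (simp add: power2_eq_square)
    also have "real (card (permutations_of_multiset M)) = fact d / (\<Prod>t\<in>UNIV. fact (count M t))"
      using M by (subst card_permutations_of_multiset_real[of UNIV]) (auto simp: multisets_of_size_def)
    also have "(\<Prod>t\<in>#M. (cmod (F t))\<^sup>2) = (\<Prod>t\<in>UNIV. ((cmod (F t))\<^sup>2) ^ count M t)"
      unfolding image_prod_mset_multiplicity
      by (intro prod.mono_neutral_left) (auto simp: not_in_iff)
    finally show "(\<Sum>w | w \<in> W \<and> mset w = M.
      1 / real q ^ d * real (card (permutations_of_multiset (mset w))) * (\<Prod>t\<in>#mset w. (cmod (F t))\<^sup>2)) =
      (fact d)\<^sup>2 / real q ^ d * (\<Prod>t\<in>UNIV. ((cmod (F t))\<^sup>2) ^ count M t / (fact (count M t))\<^sup>2)"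
      by (simp add: power_divide prod_dividef prod_power_distrib)
  qed
  finally show ?thesis
    by (simp add: bessel_coeff_eq_sum sum_distrib_left q_def F_def)
qed

section \<open>The sharp inequality and its maximizers\<close>

lemma norm_extension_op_le_and_eq_iff:
  fixes f :: "(nat \<Rightarrow> 'a :: finite_field) \<Rightarrow> complex"
  assumes p: "prime p" and card: "CARD('a) = p ^ n" and d: "2 \<le> d" "d < p"
  shows "norm_L (2 * d) d (extension_op p n d f) \<le> sharp_const (p ^ n) d * norm_L2_curve d f"
    and "norm_L (2 * d) d (extension_op p n d f) = sharp_const (p ^ n) d * norm_L2_curve d f \<longleftrightarrow>
      (\<exists>c. \<forall>\<xi>\<in>moment_curve d. cmod (f \<xi>) = c)"
proof -
  define q where "q = CARD('a)"
  define a where "a = (\<lambda>t. (cmod (f (curve_point d t)))\<^sup>2)"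
  define \<mu> where "\<mu> = (\<Sum>t\<in>UNIV. a t) / real q"
  define K where "K = (fact d)\<^sup>2 / real q ^ d"
  have "q > 0" by (simp add: q_def)
  then have "K > 0" by (simp add: K_def)
  have a_nonneg: "0 \<le> a t" for t by (simp add: a_def)
  have "0 \<le> \<mu>" by (simp add: \<mu>_def sum_nonneg a_nonneg)
  have "n \<noteq> 0" using card by (rule finite_field_exponent_nonzero)
  then have "p \<le> q"
    using prime_ge_1_nat[OF p] unfolding q_def card by (intro self_le_power) auto
  with d have "d \<le> q" by simp
  \<comment> \<open>Both sides of the inequality are brought to the form \<open>(K * bessel_coeff d _) powr (1 / (2 * d))\<close>.\<close>
  have lhs: "norm_L (2 * d) d (extension_op p n d f) = (K * bessel_coeff d a) powr (1 / real (2 * d))"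
    unfolding norm_L_def using d by (subst sum_norm_extension_op[OF p card]) (simp_all add: K_def q_def a_def)
  have "sharp_const (p ^ n) d = (K * bessel_coeff d (\<lambda>_ :: 'a. 1)) powr (1 / real (2 * d))"
    using fact_sq_bessel_coeff_one[where 'a = 'a, of d] \<open>d \<le> q\<close>
    unfolding sharp_const_def card[symmetric] K_def q_def by simp
  moreover have "norm_L2_curve d f = (\<mu> ^ d) powr (1 / real (2 * d))"
  proof -
    have "norm_L2_curve d f = \<mu> powr (1 / 2)"
      using d by (simp add: norm_L2_curve_def sum_moment_curve \<mu>_def a_def q_def)
    also have "\<dots> = (\<mu> ^ d) powr (1 / real (2 * d))"
      using \<open>0 \<le> \<mu>\<close> d by (cases "\<mu> = 0") (simp_all add: powr_powr flip: powr_realpow)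
    finally show ?thesis .
  qed
  ultimately have "sharp_const (p ^ n) d * norm_L2_curve d f =
      (K * (\<mu> ^ d * bessel_coeff d (\<lambda>_ :: 'a. 1))) powr (1 / real (2 * d))"
    using \<open>0 \<le> \<mu>\<close> \<open>K > 0\<close> by (simp add: powr_mult bessel_coeff_nonneg mult_ac)
  also have "\<mu> ^ d * bessel_coeff d (\<lambda>_ :: 'a. 1) = bessel_coeff d (\<lambda>_ :: 'a. \<mu>)"
    using bessel_coeff_scale[of d \<mu> "\<lambda>_ :: 'a. 1"] by simp
  finally have rhs: "sharp_const (p ^ n) d * norm_L2_curve d f =
      (K * bessel_coeff d (\<lambda>_ :: 'a. \<mu>)) powr (1 / real (2 * d))" .
  have const_iff: "(\<exists>c. \<forall>\<xi>\<in>moment_curve d. cmod (f \<xi>) = c) \<longleftrightarrow> (\<forall>t. a t = \<mu>)"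
  proof
    assume "\<exists>c. \<forall>\<xi>\<in>moment_curve d. cmod (f \<xi>) = c"
    then obtain c where c: "a t = c\<^sup>2" for t by (auto simp: a_def moment_curve_eq)
    then have "\<mu> = c\<^sup>2" using \<open>q > 0\<close> by (simp add: \<mu>_def q_def)
    with c show "\<forall>t. a t = \<mu>" by simp
  next
    assume "\<forall>t. a t = \<mu>"
    then have "cmod (f (curve_point d t)) = sqrt \<mu>" for t
      by (intro real_sqrt_unique[symmetric]) (auto simp: a_def)
    then show "\<exists>c. \<forall>\<xi>\<in>moment_curve d. cmod (f \<xi>) = c" by (auto simp: moment_curve_eq)
  qed
  have "norm_L (2 * d) d (extension_op p n d f) \<le> sharp_const (p ^ n) d * norm_L2_curve d f \<and>
    (norm_L (2 * d) d (extension_op p n d f) = sharp_const (p ^ n) d * norm_L2_curve d f \<longleftrightarrow>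
      (\<forall>t. a t = \<mu>))"
  proof (cases "\<forall>t. a t = \<mu>")
    case True
    then have "a = (\<lambda>_. \<mu>)" by auto
    with True show ?thesis by (simp add: lhs rhs)
  next
    case False
    have "(\<Sum>t\<in>UNIV. a t) = real CARD('a) * \<mu>" by (simp add: \<mu>_def q_def)
    then have "bessel_coeff d a < bessel_coeff d (\<lambda>_ :: 'a. \<mu>)"
      using False by (intro bessel_coeff_less_mean a_nonneg d) auto
    moreover have "0 \<le> bessel_coeff d a" by (rule bessel_coeff_nonneg[OF a_nonneg])
    ultimately have "(K * bessel_coeff d a) powr (1 / real (2 * d)) <
        (K * bessel_coeff d (\<lambda>_ :: 'a. \<mu>)) powr (1 / real (2 * d))"
      using \<open>K > 0\<close> d by (intro powr_less_mono2) simp_all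
    with False show ?thesis by (simp add: lhs rhs)
  qed
  then show "norm_L (2 * d) d (extension_op p n d f) \<le> sharp_const (p ^ n) d * norm_L2_curve d f"
    and "norm_L (2 * d) d (extension_op p n d f) = sharp_const (p ^ n) d * norm_L2_curve d f \<longleftrightarrow>
      (\<exists>c. \<forall>\<xi>\<in>moment_curve d. cmod (f \<xi>) = c)"
    by (simp_all add: const_iff)
qed

theorem theorem2:
  fixes p n d :: nat
  assumes "2 \<le> d" and "d \<le> 20"
    and "prime p" and "d < p"
    and "1 \<le> n"
    and "CARD('a :: finite_field) = p ^ n"
  shows
    "(\<forall>f :: (nat \<Rightarrow> 'a) \<Rightarrow> complex.
        norm_L (2 * d) d (extension_op p n d f) \<le> sharp_const (p ^ n) d * norm_L2_curve d f) \<and>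
     (\<forall>C :: real.
        (\<forall>f :: (nat \<Rightarrow> 'a) \<Rightarrow> complex.
           norm_L (2 * d) d (extension_op p n d f) \<le> C * norm_L2_curve d f)
        \<longrightarrow> sharp_const (p ^ n) d \<le> C) \<and>
     (\<forall>f :: (nat \<Rightarrow> 'a) \<Rightarrow> complex.
        (\<exists>\<xi>\<in>moment_curve d. f \<xi> \<noteq> 0) \<longrightarrow>
        (is_maximizer p n d f \<longleftrightarrow> (\<exists>c. \<forall>\<xi>\<in>moment_curve d. cmod (f \<xi>) = c)))"
proof (intro conjI allI impI)
  fix C :: real
  assume C: "\<forall>f :: (nat \<Rightarrow> 'a) \<Rightarrow> complex.
    norm_L (2 * d) d (extension_op p n d f) \<le> C * norm_L2_curve d f"
  let ?one = "\<lambda>_ :: nat \<Rightarrow> 'a. 1 :: complex"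
  have "norm_L2_curve d ?one = 1"
    unfolding norm_L2_curve_def using assms(1) by (subst sum_moment_curve) simp_all
  moreover have "norm_L (2 * d) d (extension_op p n d ?one) = sharp_const (p ^ n) d * norm_L2_curve d ?one"
    using norm_extension_op_le_and_eq_iff(2)[OF assms(3,6,1,4), of ?one] by simp
  ultimately show "sharp_const (p ^ n) d \<le> C"
    using C[rule_format, of ?one] by simp
qed (use norm_extension_op_le_and_eq_iff[OF assms(3,6,1,4)] in \<open>auto simp: is_maximizer_def\<close>)

end
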